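(* Let $N<0$, let $(X,d,p)$ be a pointed Polish space and $\mathcal S\subset X$ a closed subset with empty interior. Then the Rényi entropy functional $S_{N,\mathfrak n}(\nu)$ is a lower semicontinuous function of $(\mathfrak n,\nu)\in\mathscr M_{\mathcal S}(X)\times\mathscr P^{\mathcal S}(X)$. Specifically, for sequences $(\mathfrak n_n)_{n\in\mathbb N\cup\{\infty\}}\subset\mathscr M_{\mathcal S}(X)$ and $(\nu_n)_{n\in\mathbb N\cup\{\infty\}}\subset\mathscr P^{\mathcal S}(X)$ such that $\mathfrak n_n\overset{*}{\rightharpoonup}\mathfrak n_\infty$ as quasi-Radon measures and $\nu_n\rightharpoonup\nu_\infty$ weakly (as probability measures), one has $$S_{N,\mathfrak n_\infty}(\nu_\infty)\le\liminf_{n\to\infty}S_{N,\mathfrak n_n}(\nu_n).$$ In particular, the conclusion remains valid under $W_2$-convergence in the second argument.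
   Context: A Polish space is a complete separable metric space. A Borel measure is Radon if it is complete, locally finite and inner regular with respect to compact sets; it is quasi-Radon if it is complete, inner regular with respect to closed sets and effectively locally finite (for every measurable $A$ of positive measure there is an open $U$ of finite measure with $\mathfrak m(A\cap U)>0$). For a closed set $S\subset X$ with empty interior, a neighbourhood of $S$ is a Borel set containing an open set that contains $S$; $\mathscr M_S(X)$ is the set of quasi-Radon measures $\mathfrak m$ on $X$ with $\mathfrak m(S)=0$ such that for every neighbourhood $U$ of $S$ the restriction $\mathfrak m|_{X\setminus U}$ is a Radon measure finite on bounded sets. $C_{bs}(X)$ is the set of bounded continuous functions with bounded support and $C_S(X)$ the set of continuous functions on $X$ vanishing on some neighbourhood of $S$. For $\mathfrak m_n,\mathfrak m_\infty\in\mathscr M_S(X)$, $\mathfrak m_n\overset{*}{\rightharpoonup}\mathfrak m_\infty$ means $\int f\,d\mathfrak m_n\to\int f\,d\mathfrak m_\infty$ for every $f\in C_{bs}(X)\cap C_S(X)$. $\mathscr P_2(X)$ is the set of Borel probability measures with finite second moment; $\mathscr P^{\mathcal S}(X)=\{\mu\in\mathscr P_2(X):\mu(\mathcal S)=0\}$. Weak convergence $\rightharpoonup$ of probability measures is in duality with bounded continuous functions. For $N<0$, $S_{N,\mathfrak m}(\mu)=\int\rho^{(N-1)/N}\,d\mathfrak m$ if $\mu=\rho\,\mathfrak m\ll\mathfrak m$, and $+\infty$ otherwise. *)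

theory Defs
  imports "HOL-Probability.Probability"
begin

section \<open>Radon and quasi-Radon measures\<close>

text \<open>
  The carrier of a measure is regarded as a topological subspace of the ambient metric space.
  Since Radon and quasi-Radon measures are complete, their domain contains, but usually does not
  equal, the Borel sigma-algebra.
\<close>

definition borel_on :: "'a::topological_space measure \<Rightarrow> bool" where
  "borel_on M \<longleftrightarrow> sets (restrict_space borel (space M)) \<subseteq> sets M"

definition radon_measure :: "'a::topological_space measure \<Rightarrow> bool" where
  "radon_measure M \<longleftrightarrow>
     borel_on M \<and> complete_measure M \<and>
     (\<forall>x\<in>space M. \<exists>U. open U \<and> x \<in> U \<and> emeasure M (U \<inter> space M) < \<infinity>) \<and>
     (\<forall>A\<in>sets M. emeasure M A = (SUP K\<in>{K. compact K \<and> K \<subseteq> A}. emeasure M K))"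

definition quasi_radon_measure :: "'a::topological_space measure \<Rightarrow> bool" where
  "quasi_radon_measure M \<longleftrightarrow>
     space M = UNIV \<and> borel_on M \<and> complete_measure M \<and>
     (\<forall>A\<in>sets M. emeasure M A = (SUP K\<in>{K. closed K \<and> K \<subseteq> A}. emeasure M K)) \<and>
     (\<forall>A\<in>sets M. emeasure M A > 0 \<longrightarrow>
        (\<exists>U. open U \<and> emeasure M U < \<infinity> \<and> emeasure M (A \<inter> U) > 0))"

definition nbhd :: "'a::topological_space set \<Rightarrow> 'a set \<Rightarrow> bool" where
  "nbhd S U \<longleftrightarrow> U \<in> sets borel \<and> (\<exists>V. open V \<and> S \<subseteq> V \<and> V \<subseteq> U)"

text \<open>
  The restriction of \<open>m\<close> to the complement of \<open>U\<close> is the subspace measure, which, unlike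
  \<open>A \<mapsto> m (A - U)\<close> on the domain of \<open>m\<close>, is complete whenever \<open>m\<close> is.
\<close>

definition measures_off :: "'a::metric_space set \<Rightarrow> 'a measure set" where
  "measures_off S =
     {m. quasi_radon_measure m \<and> emeasure m S = 0 \<and>
         (\<forall>U. nbhd S U \<longrightarrow>
            radon_measure (restrict_space m (- U)) \<and>
            (\<forall>B\<in>sets (restrict_space m (- U)). bounded B \<longrightarrow>
               emeasure (restrict_space m (- U)) B < \<infinity>))}"

section \<open>Convergence in duality with functions vanishing near the singular set\<close>

definition C_bs :: "('a::metric_space \<Rightarrow> real) set" where
  "C_bs = {f. continuous_on UNIV f \<and> bounded (range f) \<and> bounded (closure {x. f x \<noteq> 0})}"

definition C_off :: "'a::topological_space set \<Rightarrow> ('a \<Rightarrow> real) set" where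
  "C_off S = {f. continuous_on UNIV f \<and> (\<exists>U. nbhd S U \<and> (\<forall>x\<in>U. f x = 0))}"

definition weak_star_conv_off ::
    "'a::metric_space set \<Rightarrow> (nat \<Rightarrow> 'a measure) \<Rightarrow> 'a measure \<Rightarrow> bool" where
  "weak_star_conv_off S m m_lim \<longleftrightarrow>
     (\<forall>f\<in>C_bs \<inter> C_off S. (\<lambda>n. integral\<^sup>L (m n) f) \<longlonglongrightarrow> integral\<^sup>L m_lim f)"

section \<open>Probability measures\<close>

text \<open>
  The second moment is taken about the base point \<open>p\<close>; by the triangle inequality its
  finiteness does not depend on \<open>p\<close>.
\<close>

definition P2 :: "'a::metric_space \<Rightarrow> 'a measure set" where
  "P2 p = {\<mu>. prob_space \<mu> \<and> sets \<mu> = sets borel \<and>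
              (\<integral>\<^sup>+x. ennreal ((dist p x)\<^sup>2) \<partial>\<mu>) < \<infinity>}"

definition P2_off :: "'a::metric_space \<Rightarrow> 'a set \<Rightarrow> 'a measure set" where
  "P2_off p S = {\<mu>\<in>P2 p. emeasure \<mu> S = 0}"

definition weak_conv_prob ::
    "(nat \<Rightarrow> 'a::topological_space measure) \<Rightarrow> 'a measure \<Rightarrow> bool" where
  "weak_conv_prob \<nu> \<nu>_lim \<longleftrightarrow>
     (\<forall>f::'a \<Rightarrow> real. continuous_on UNIV f \<and> bounded (range f) \<longrightarrow>
        (\<lambda>n. integral\<^sup>L (\<nu> n) f) \<longlonglongrightarrow> integral\<^sup>L \<nu>_lim f)"

definition couplings ::
    "'a::topological_space measure \<Rightarrow> 'a measure \<Rightarrow> ('a \<times> 'a) measure set" where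
  "couplings \<mu> \<nu> = {\<pi>. prob_space \<pi> \<and> sets \<pi> = sets borel \<and>
                          distr \<pi> borel fst = \<mu> \<and> distr \<pi> borel snd = \<nu>}"

text \<open>
  For measures with finite second moment the product coupling has finite cost, so the infimum
  is finite there and \<^const>\<open>enn2real\<close> loses nothing; elsewhere the value is meaningless.
\<close>

definition W2 :: "'a::metric_space measure \<Rightarrow> 'a measure \<Rightarrow> real" where
  "W2 \<mu> \<nu> =
     sqrt (enn2real (INF \<pi>\<in>couplings \<mu> \<nu>. \<integral>\<^sup>+z. ennreal ((dist (fst z) (snd z))\<^sup>2) \<partial>\<pi>))"

section \<open>Renyi entropy\<close>

text \<open>
  The reference measure \<open>m\<close> lives on a completed sigma-algebra and \<open>\<mu>\<close> on the Borel one,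
  whereas \<^const>\<open>absolutely_continuous\<close> and \<^const>\<open>RN_deriv\<close> compare measures on the same
  sigma-algebra; hence \<open>m\<close> is first restricted to the Borel sets.
  For \<open>m \<in> measures_off S\<close> this restriction is sigma-finite, so the density of an absolutely
  continuous \<open>\<mu>\<close> exists, is unique and finite almost everywhere, and the passage to \<^typ>\<open>real\<close>
  is harmless.
\<close>

definition borel_part :: "'a::topological_space measure \<Rightarrow> 'a measure" where
  "borel_part m = distr m borel (\<lambda>x. x)"

definition renyi_entropy :: "real \<Rightarrow> 'a::topological_space measure \<Rightarrow> 'a measure \<Rightarrow> ennreal" where
  "renyi_entropy N m \<mu> =
     (if absolutely_continuous (borel_part m) \<mu>
      then \<integral>\<^sup>+x. ennreal (enn2real (RN_deriv (borel_part m) \<mu> x) powr ((N - 1) / N)) \<partial>m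
      else \<infinity>)"

end

theory Submission
  imports Defs
begin

text \<open>
  Let \<open>q = (N - 1) / N > 1\<close> with conjugate exponent \<open>r\<close>. Integrating Young's inequality
  \<open>q a b \<le> a\<^sup>q + (q - 1) b\<^sup>r\<close> gives \<open>q \<integral>f d\<nu> \<le> S\<^sub>N(\<nu>) + (q - 1) \<integral>f\<^sup>r dm\<close> for nonnegative
  \<open>f\<close>. For Lipschitz \<open>f\<close> supported in a bounded set at positive distance from \<open>S\<close> both integrals
  pass to the limit, so the limit measures satisfy this bound with the lower limit of the entropies
  in place of \<open>S\<^sub>N\<close>. Inner regularity of the limit probability measure extends it to all nonnegative
  Borel functions. Multiples of the indicator of a null set then give absolute continuity, and
  truncations of \<open>\<rho>\<^sup>q\<^sup>-\<^sup>1\<close>, the equality case in Young's inequality, give the entropy bound.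
  Since only Lipschitz functions are tested against probability measures, \<open>W\<^sub>2\<close>-convergence is
  handled in the same way as weak convergence.
\<close>

section \<open>Test functions vanishing near the singular set\<close>

text \<open>The distance condition quantifies over the points of \<open>S\<close> instead of using
  \<open>infdist\<close>, since \<open>infdist x {} = 0\<close> would make all these sets empty for
  \<open>S = {}\<close>. For closed \<open>S\<close> they increase to the complement of
  \<open>S\<close>.\<close>

definition away :: "'a::metric_space \<Rightarrow> 'a set \<Rightarrow> nat \<Rightarrow> 'a set" where
  "away p S k = cball p (real k) \<inter> {x. \<forall>s\<in>S. 1 / real (Suc k) \<le> dist x s}"

lemma away_altdef: "away p S k = cball p (real k) - (\<Union>s\<in>S. ball s (1 / real (Suc k)))"
  by (auto simp: away_def not_less dist_commute)

lemma closed_away: "closed (away p S k)"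
  unfolding away_altdef by (intro closed_Diff closed_cball open_UN) auto

lemma bounded_away: "bounded (away p S k)"
  unfolding away_altdef by (rule bounded_subset[OF bounded_cball]) auto

lemma away_mono: "k \<le> l \<Longrightarrow> away p S k \<subseteq> away p S l"
proof
  fix x assume "k \<le> l" "x \<in> away p S k"
  moreover have "1 / real (Suc l) \<le> 1 / real (Suc k)"
    using \<open>k \<le> l\<close> by (simp add: frac_le)
  ultimately show "x \<in> away p S l"
    unfolding away_def by (force intro: order_trans)
qed

lemma nbhd_away: "nbhd S (- away p S k)"
proof -
  have "open (- away p S k)" using closed_away by auto
  moreover have "S \<subseteq> - away p S k" by (force simp: away_def)
  ultimately show ?thesis by (auto simp: nbhd_def)
qed

text \<open>A compact set is bounded and has positive distance from a disjoint closed set, so a thin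
  enough neighbourhood of it keeps both properties. This leaves room for cutoff functions around
  \<open>K\<close> inside a single set \<open>away p S k\<close>.\<close>

lemma thickening_subset_away:
  fixes S :: "'a::metric_space set"
  assumes "compact K" "K \<noteq> {}" "closed S" "K \<inter> S = {}"
  shows "\<exists>k. \<forall>x. infdist x K \<le> 1 / real (Suc k) \<longrightarrow> x \<in> away p S k"
proof -
  have "\<exists>d>0. \<forall>x\<in>K. \<forall>s\<in>S. d \<le> dist x s"
  proof (cases "S = {}")
    case True then show ?thesis by (auto intro: exI[of _ 1])
  next
    case False
    have "continuous_on K (\<lambda>x. infdist x S)" by (intro continuous_intros)
    then obtain x0 where x0: "x0 \<in> K" "\<forall>x\<in>K. infdist x0 S \<le> infdist x S"
      using continuous_attains_inf[OF assms(1,2)] by blast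
    have "0 < infdist x0 S"
      using assms x0(1) False by (intro infdist_pos_not_in_closed) auto
    then show ?thesis using x0(2)
      by (intro exI[of _ "infdist x0 S"]) (auto intro: order_trans infdist_le)
  qed
  then obtain d where d: "d > 0" "\<And>x s. x \<in> K \<Longrightarrow> s \<in> S \<Longrightarrow> d \<le> dist x s" by blast
  obtain R where R: "\<And>x. x \<in> K \<Longrightarrow> dist p x \<le> R"
    using compact_imp_bounded[OF assms(1)] bounded_any_center[of K p] by blast
  \<comment> \<open>The points considered lie within \<open>2 / real (Suc k)\<close> of
    \<open>K\<close>. The first bound absorbs this error in the distance to \<open>p\<close>; the
    second leaves \<open>1 / real (Suc k)\<close> of the distance \<open>d\<close> to
    \<open>S\<close>.\<close>
  obtain k :: nat where k: "real k \<ge> max (R + 2) (3 / d)"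
    using real_arch_simple by blast
  have kd: "3 / real (Suc k) \<le> d"
    using k d(1) by (simp add: field_simps)
  have k1: "1 / real (Suc k) \<le> 1" by simp
  show ?thesis
  proof (intro exI[of _ k] allI impI)
    fix x assume x: "infdist x K \<le> 1 / real (Suc k)"
    have "0 < 1 / real (Suc k)" by simp
    moreover have "2 / real (Suc k) = 1 / real (Suc k) + 1 / real (Suc k)"
      by (simp add: field_simps)
    \<comment> \<open>The strict inequality gives a nearby point of \<open>K\<close> straight from
      the definition of the infimum, without appeal to attainment.\<close>
    ultimately have "infdist x K < 2 / real (Suc k)" using x by linarith
    then obtain y where y: "y \<in> K" "dist x y < 2 / real (Suc k)"
      unfolding infdist_notempty[OF assms(2)]
      by (subst (asm) cINF_less_iff) (use assms(2) in \<open>auto intro: bdd_belowI2[where m=0]\<close>)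
    have "dist p x \<le> dist p y + dist x y" by (metis dist_commute dist_triangle)
    also have "\<dots> \<le> R + 2"
    proof -
      have "2 / real (Suc k) \<le> 2 / 1" by (intro divide_left_mono) auto
      then show ?thesis using R[OF y(1)] y(2) by linarith
    qed
    finally have "dist p x \<le> real k" using k by simp
    moreover have "1 / real (Suc k) \<le> dist x s" if "s \<in> S" for s
    proof -
      have "d \<le> dist y s" using d(2)[OF y(1) that] .
      also have "\<dots> \<le> dist x y + dist x s" by (metis dist_commute dist_triangle)
      finally have "d \<le> dist x y + dist x s" .
      moreover have "3 / real (Suc k) = 1 / real (Suc k) + 2 / real (Suc k)"
        by (simp add: field_simps)
      ultimately show ?thesis using kd y(2) by linarith
    qed
    ultimately show "x \<in> away p S k" by (auto simp: away_def)
  qed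
qed

lemma away_exhausts:
  assumes "closed S" "x \<notin> S" shows "\<exists>k. x \<in> away p S k"
proof -
  obtain k where "\<And>y. infdist y {x} \<le> 1 / real (Suc k) \<Longrightarrow> y \<in> away p S k"
    using thickening_subset_away[of "{x}" S p] assms by auto
  then show ?thesis by (intro exI[of _ k]) simp
qed

text \<open>The index \<open>k\<close> and the bound \<open>C\<close> are parameters so that a whole
  sequence of functions can share them. The Lipschitz constant stays existential because it may blow
  up along such a sequence.\<close>

definition test_fun :: "'a::metric_space \<Rightarrow> 'a set \<Rightarrow> nat \<Rightarrow> real \<Rightarrow> ('a \<Rightarrow> real) \<Rightarrow> bool" where
  "test_fun p S k C f \<longleftrightarrow> (\<exists>L. L-lipschitz_on UNIV f) \<and>
     (\<forall>x. 0 \<le> f x \<and> f x \<le> C) \<and> (\<forall>x. x \<notin> away p S k \<longrightarrow> f x = 0)"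

lemma test_fun_add:
  assumes "test_fun p S k C f" "test_fun p S l D g"
  shows "test_fun p S (max k l) (C + D) (\<lambda>x. f x + g x)"
proof -
  obtain L M where "L-lipschitz_on UNIV f" "M-lipschitz_on UNIV g"
    using assms by (auto simp: test_fun_def)
  then have "(L + M)-lipschitz_on UNIV (\<lambda>x. f x + g x)" by (rule lipschitz_on_add)
  moreover have "f x + g x = 0" if "x \<notin> away p S (max k l)" for x
  proof -
    have "x \<notin> away p S k" "x \<notin> away p S l"
      using that away_mono[of k "max k l" p S] away_mono[of l "max k l" p S] by auto
    then show ?thesis using assms by (simp add: test_fun_def)
  qed
  ultimately show ?thesis using assms unfolding test_fun_def by (auto intro: add_mono)
qed

lemma test_fun_cmult:
  assumes "test_fun p S k C f" "0 \<le> a"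
  shows "test_fun p S k (a * C) (\<lambda>x. a * f x)"
proof -
  obtain L where "L-lipschitz_on UNIV f" using assms(1) by (auto simp: test_fun_def)
  then have "(\<bar>a\<bar> * L)-lipschitz_on UNIV (\<lambda>x. a * f x)" by (rule lipschitz_on_cmult_real)
  then show ?thesis using assms unfolding test_fun_def by (auto intro: mult_left_mono)
qed

lemma test_fun_continuous: "test_fun p S k C f \<Longrightarrow> continuous_on UNIV f"
  unfolding test_fun_def using lipschitz_on_continuous_on by blast

lemma test_fun_measurable: "test_fun p S k C f \<Longrightarrow> f \<in> borel_measurable borel"
  using test_fun_continuous borel_measurable_continuous_onI by blast

text \<open>Young's inequality integrates \<open>f\<close> against the probability measure but
  \<open>f powr r\<close> against the reference measure, so it is this power that has to be
  admissible for the convergence of the reference measures.\<close>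

lemma powr_test_fun_in_C:
  assumes "test_fun p S k C f" "0 < r"
  shows "(\<lambda>x. f x powr r) \<in> C_bs \<inter> C_off S"
proof -
  have f: "\<And>x. 0 \<le> f x" "\<And>x. f x \<le> C" "\<And>x. x \<notin> away p S k \<Longrightarrow> f x = 0"
    using assms(1) by (auto simp: test_fun_def)
  have "continuous_on UNIV (\<lambda>x. f x powr r)"
    using f assms(2) test_fun_continuous[OF assms(1)]
    by (intro continuous_on_powr' continuous_intros) auto
  moreover have "bounded (range (\<lambda>x. f x powr r))"
    using f assms(2) by (intro boundedI[where B="C powr r"]) (auto intro!: powr_mono2)
  moreover have "bounded (closure {x. f x powr r \<noteq> 0})"
    using f(3) by (intro bounded_closure bounded_subset[OF bounded_away[of p S k]]) auto
  moreover have "\<exists>U. nbhd S U \<and> (\<forall>x\<in>U. f x powr r = 0)"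
    using nbhd_away[of S p k] f(3) by (intro exI[of _ "- away p S k"]) auto
  ultimately show ?thesis by (auto simp: C_bs_def C_off_def)
qed

text \<open>The common \<open>k\<close> and \<open>C\<close> supply the dominating functions that
  carry an integral bound to the pointwise limit, for the probability measure and the reference
  measure alike.\<close>

definition approx_by_tests :: "'a::metric_space \<Rightarrow> 'a set \<Rightarrow> ('a \<Rightarrow> real) \<Rightarrow> bool" where
  "approx_by_tests p S h \<longleftrightarrow>
     (\<exists>f k C. (\<forall>j. test_fun p S k C (f j)) \<and> (\<forall>x. (\<lambda>j. f j x) \<longlonglongrightarrow> h x))"

text \<open>Tent functions of increasing slope over the distance to \<open>K\<close> decrease to the
  indicator, as \<open>K\<close> is closed. The empty set is treated apart: \<open>infdist\<close>
  to it is 0, so its tents would be constantly 1.\<close>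

lemma approx_by_tests_indicator:
  fixes S :: "'a::metric_space set"
  assumes "compact K" "closed S" "K \<inter> S = {}"
  shows "approx_by_tests p S (indicator K)"
proof (cases "K = {}")
  case True
  then show ?thesis unfolding approx_by_tests_def test_fun_def
    by (intro exI[of _ "\<lambda>_ _. 0"] exI[of _ 0]) (auto intro: lipschitz_on_constant)
next
  case False
  obtain k where k: "\<And>x. infdist x K \<le> 1 / real (Suc k) \<Longrightarrow> x \<in> away p S k"
    using thickening_subset_away[OF assms(1) False assms(2,3)] by blast
  \<comment> \<open>The slope is at least \<open>Suc k\<close>, so every \<open>f j\<close> vanishes
    beyond distance \<open>1 / real (Suc k)\<close> from \<open>K\<close>, hence outside
    \<open>away p S k\<close>.\<close>
  define f where "f j x = max 0 (1 - real (j + Suc k) * infdist x K)" for j x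
  have "test_fun p S k 1 (f j)" for j
  proof -
    have "(real (j + Suc k))-lipschitz_on UNIV (f j)"
    proof (rule lipschitz_onI)
      fix x y :: 'a
      have "dist (f j x) (f j y) \<le> \<bar>real (j + Suc k) * (infdist x K - infdist y K)\<bar>"
        unfolding f_def dist_real_def right_diff_distrib by linarith
      also have "\<dots> \<le> real (j + Suc k) * dist x y"
        unfolding abs_mult by (intro mult_mono infdist_triangle_abs) auto
      finally show "dist (f j x) (f j y) \<le> real (j + Suc k) * dist x y" .
    qed auto
    moreover have "f j x = 0" if "x \<notin> away p S k" for x
    proof -
      have "1 / real (Suc k) < infdist x K"
        using k[of x] that by fastforce
      then have "1 < infdist x K * real (Suc k)"
        by (simp add: field_simps)
      also have "\<dots> \<le> infdist x K * real (j + Suc k)"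
        by (intro mult_left_mono infdist_nonneg) auto
      finally show ?thesis by (simp add: f_def mult.commute)
    qed
    ultimately show ?thesis
      by (auto simp: test_fun_def f_def infdist_nonneg)
  qed
  moreover have "(\<lambda>j. f j x) \<longlonglongrightarrow> indicator K x" for x
  proof (cases "x \<in> K")
    case True
    then show ?thesis by (simp add: f_def)
  next
    case F: False
    have pos: "infdist x K > 0"
      using F False assms(1) by (intro infdist_pos_not_in_closed compact_imp_closed) auto
    obtain n :: nat where n: "real n \<ge> 1 / infdist x K" using real_arch_simple by blast
    have "f j x = 0" if "j \<ge> n" for j
    proof -
      have "1 / infdist x K \<le> real (j + Suc k)" using n that by linarith
      then show ?thesis using pos by (simp add: f_def field_simps)
    qed
    then have "eventually (\<lambda>j. f j x = 0) sequentially"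
      using eventually_sequentially by blast
    then show ?thesis using F by (simp add: tendsto_eventually)
  qed
  ultimately show ?thesis unfolding approx_by_tests_def by blast
qed

lemma approx_by_tests_add:
  assumes "approx_by_tests p S f" "approx_by_tests p S g"
  shows "approx_by_tests p S (\<lambda>x. f x + g x)"
proof -
  obtain u k C where "\<And>j. test_fun p S k C (u j)" "\<And>x. (\<lambda>j. u j x) \<longlonglongrightarrow> f x"
    using assms(1) unfolding approx_by_tests_def by blast
  moreover obtain v l D where "\<And>j. test_fun p S l D (v j)" "\<And>x. (\<lambda>j. v j x) \<longlonglongrightarrow> g x"
    using assms(2) unfolding approx_by_tests_def by blast
  ultimately show ?thesis unfolding approx_by_tests_def
    by (intro exI[of _ "\<lambda>j x. u j x + v j x"] exI[of _ "max k l"] exI[of _ "C + D"])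
       (auto intro: test_fun_add tendsto_add)
qed

lemma approx_by_tests_cmult:
  assumes "approx_by_tests p S f" "0 \<le> a"
  shows "approx_by_tests p S (\<lambda>x. a * f x)"
proof -
  obtain u k C where "\<And>j. test_fun p S k C (u j)" "\<And>x. (\<lambda>j. u j x) \<longlonglongrightarrow> f x"
    using assms(1) unfolding approx_by_tests_def by blast
  then show ?thesis using assms(2) unfolding approx_by_tests_def
    by (intro exI[of _ "\<lambda>j x. a * u j x"] exI[of _ k] exI[of _ "a * C"])
       (auto intro: test_fun_cmult tendsto_mult_left)
qed

lemma approx_by_tests_sum:
  assumes "finite I" "closed S"
    and "\<And>i. i \<in> I \<Longrightarrow> 0 \<le> b i \<and> compact (K i) \<and> K i \<inter> S = {}"
  shows "approx_by_tests p S (\<lambda>x. \<Sum>i\<in>I. b i * indicator (K i) x)"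
  using assms(1,3)
proof (induction I rule: finite_induct)
  case empty
  then show ?case
    using approx_by_tests_indicator[of "{}" S p] assms(2) by (simp add: indicator_def[abs_def])
next
  case (insert i I)
  have "approx_by_tests p S (\<lambda>x. b i * indicator (K i) x + (\<Sum>i\<in>I. b i * indicator (K i) x))"
    using insert.prems[of i]
    by (intro approx_by_tests_add approx_by_tests_cmult approx_by_tests_indicator assms(2)
        insert.IH insert.prems) auto
  then show ?case using insert.hyps by (simp del: sum_mult_indicator)
qed

section \<open>The dual bound and its consequences\<close>

lemma young_powr:
  fixes a b q r :: real
  assumes "1 < q" "r = q / (q - 1)" "0 \<le> a" "0 \<le> b"
  shows "q * (a * b) \<le> a powr q + (q - 1) * b powr r"
proof -
  have r: "1 < r" "1 / q + 1 / r = 1" "q / r = q - 1"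
    using assms(1) unfolding assms(2) by (auto simp: field_simps)
  \<comment> \<open>The factor \<open>q\<close> gives the entropy integrand \<open>a powr q\<close>
    coefficient 1; the other coefficient becomes \<open>q / r = q - 1\<close>.\<close>
  have "q * (a * b) \<le> q * (a powr q / q + b powr r / r)"
    using Youngs_inequality[of q r a b] assms r by (intro mult_left_mono) auto
  also have "\<dots> = a powr q + (q / r) * b powr r"
    using assms by (simp add: field_simps)
  finally show ?thesis unfolding r(3) .
qed

text \<open>The integral of \<open>f\<close> against \<open>\<nu>\<close> is that of density times
  \<open>f\<close> against \<open>M\<close>, and Young's inequality applies to this product
  pointwise. The density is finite almost everywhere because \<open>\<nu>\<close> is sigma-finite,
  so \<open>enn2real\<close> does not alter it there.\<close>

lemma nn_integral_young_RN_deriv: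
  assumes "sigma_finite_measure M" "sigma_finite_measure \<nu>"
    and "sets \<nu> = sets M" "absolutely_continuous M \<nu>"
    and "1 < q" "r = q / (q - 1)"
    and [measurable]: "f \<in> borel_measurable M" and "\<And>x. 0 \<le> f x"
  shows "ennreal q * (\<integral>\<^sup>+x. ennreal (f x) \<partial>\<nu>) \<le>
    (\<integral>\<^sup>+x. ennreal (enn2real (RN_deriv M \<nu> x) powr q) \<partial>M) +
    ennreal (q - 1) * (\<integral>\<^sup>+x. ennreal (f x powr r) \<partial>M)"
proof -
  interpret sigma_finite_measure M by fact
  let ?\<rho> = "RN_deriv M \<nu>"
  have fin: "AE x in M. ?\<rho> x \<noteq> \<infinity>"
    using assms by (intro RN_deriv_finite) auto
  have "ennreal q * (\<integral>\<^sup>+x. ennreal (f x) \<partial>\<nu>) = (\<integral>\<^sup>+x. ennreal q * (?\<rho> x * ennreal (f x)) \<partial>M)"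
    using assms by (simp add: RN_deriv_nn_integral nn_integral_cmult)
  also have "\<dots> \<le> (\<integral>\<^sup>+x. ennreal (enn2real (?\<rho> x) powr q) + ennreal (q - 1) * ennreal (f x powr r) \<partial>M)"
  proof (rule nn_integral_mono_AE, use fin in eventually_elim)
    fix x assume "?\<rho> x \<noteq> \<infinity>"
    then obtain a where a: "?\<rho> x = ennreal a" "0 \<le> a" by (cases "?\<rho> x") auto
    then have "ennreal q * (?\<rho> x * ennreal (f x)) = ennreal (q * (a * f x))"
      using assms by (simp add: ennreal_mult)
    also have "\<dots> \<le> ennreal (a powr q + (q - 1) * f x powr r)"
      using assms a by (intro ennreal_leI young_powr) auto
    also have "\<dots> = ennreal (enn2real (?\<rho> x) powr q) + ennreal (q - 1) * ennreal (f x powr r)"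
      using assms a by (simp add: ennreal_plus ennreal_mult)
    finally show "ennreal q * (?\<rho> x * ennreal (f x)) \<le>
      ennreal (enn2real (?\<rho> x) powr q) + ennreal (q - 1) * ennreal (f x powr r)" .
  qed
  also have "\<dots> = (\<integral>\<^sup>+x. ennreal (enn2real (?\<rho> x) powr q) \<partial>M) +
    ennreal (q - 1) * (\<integral>\<^sup>+x. ennreal (f x powr r) \<partial>M)"
    by (simp add: nn_integral_add nn_integral_cmult)
  finally show ?thesis .
qed

section \<open>Extension of the dual bound from test functions to Borel functions\<close>

lemma sigma_finite_away:
  fixes S :: "'a::metric_space set"
  assumes "sets M = sets borel" "closed S" "emeasure M S = 0"
    and "\<And>k. emeasure M (away p S k) < \<infinity>"
  shows "sigma_finite_measure M"
proof
  \<comment> \<open>The set \<open>S\<close>, which no \<open>away p S k\<close> meets, joins the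
    countable cover as a null set.\<close>
  have "(\<Union>k. away p S k) \<union> S = UNIV"
    using away_exhausts[OF assms(2)] by auto
  moreover have "space M = UNIV" using sets_eq_imp_space_eq[OF assms(1)] by simp
  ultimately show "\<exists>A. countable A \<and> A \<subseteq> sets M \<and> \<Union> A = space M \<and> (\<forall>a\<in>A. emeasure M a \<noteq> \<infinity>)"
    using assms closed_away[of p S] by (intro exI[of _ "insert S (range (away p S))"]) (auto simp: less_top)
qed

text \<open>The limit pair is isolated here from the sequences: \<open>L\<close> stands for the
  lower limit of the entropies, and \<open>test_bound\<close> is what survives of the entropy bounds
  in the limit.\<close>

locale renyi_dual_bound =
  fixes p :: "'a::polish_space" and S :: "'a set" and M \<nu> :: "'a measure"
    and q r :: real and L :: ennreal
  assumes closed_S: "closed S"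
    and sets_M [measurable_cong, simp]: "sets M = sets borel"
    and sets_\<nu> [measurable_cong, simp]: "sets \<nu> = sets borel"
    and prob_\<nu>: "prob_space \<nu>"
    and M_S: "emeasure M S = 0" and \<nu>_S: "emeasure \<nu> S = 0"
    and M_away: "\<And>k. emeasure M (away p S k) < \<infinity>"
    and q: "1 < q" and r: "r = q / (q - 1)"
    and test_bound: "\<And>k C f. test_fun p S k C f \<Longrightarrow>
      ennreal q * (\<integral>\<^sup>+x. ennreal (f x) \<partial>\<nu>) \<le> L + ennreal (q - 1) * (\<integral>\<^sup>+x. ennreal (f x powr r) \<partial>M)"
begin

sublocale \<nu>: prob_space \<nu> by (rule prob_\<nu>)

sublocale M: sigma_finite_measure M
  by (rule sigma_finite_away[OF sets_M closed_S M_S M_away])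

lemma r_pos: "0 < r" using q r by simp

lemma space_M: "space M = UNIV" and space_\<nu>: "space \<nu> = UNIV"
  using sets_eq_imp_space_eq[OF sets_M] sets_eq_imp_space_eq[OF sets_\<nu>] by auto

text \<open>Dominated convergence on both sides: by the constant \<open>C\<close> for the
  probability measure, and for \<open>M\<close> by \<open>C powr r\<close> on
  \<open>away p S k\<close>, which has finite mass.\<close>

lemma approx_bound:
  assumes "approx_by_tests p S h"
  shows "ennreal q * (\<integral>\<^sup>+x. ennreal (h x) \<partial>\<nu>) \<le> L + ennreal (q - 1) * (\<integral>\<^sup>+x. ennreal (h x powr r) \<partial>M)"
proof -
  obtain f k C where f: "\<And>j. test_fun p S k C (f j)" and lim: "\<And>x. (\<lambda>j. f j x) \<longlonglongrightarrow> h x"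
    using assms unfolding approx_by_tests_def by blast
  have fm [measurable]: "f j \<in> borel_measurable borel" for j
    using f by (rule test_fun_measurable)
  have hm [measurable]: "h \<in> borel_measurable borel"
    by (rule borel_measurable_LIMSEQ_real[OF lim]) auto
  have F: "0 \<le> f j x" "f j x \<le> C" "x \<notin> away p S k \<Longrightarrow> f j x = 0" for j x
    using f[of j] by (auto simp: test_fun_def)
  have [measurable]: "away p S k \<in> sets borel" by (rule borel_closed[OF closed_away])
  have "(\<lambda>j. \<integral>\<^sup>+x. ennreal (f j x) \<partial>\<nu>) \<longlonglongrightarrow> (\<integral>\<^sup>+x. ennreal (h x) \<partial>\<nu>)"
  proof (rule nn_integral_dominated_convergence[where w="\<lambda>_. ennreal C"])
    show "(\<integral>\<^sup>+ x. ennreal C \<partial>\<nu>) < \<infinity>" by (simp add: \<nu>.emeasure_space_1)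
  qed (use F lim in \<open>auto intro!: ennreal_leI tendsto_ennrealI\<close>)
  moreover have "(\<lambda>j. \<integral>\<^sup>+x. ennreal (f j x powr r) \<partial>M) \<longlonglongrightarrow> (\<integral>\<^sup>+x. ennreal (h x powr r) \<partial>M)"
  proof (rule nn_integral_dominated_convergence[where w="\<lambda>x. ennreal (C powr r) * indicator (away p S k) x"])
    show "(\<integral>\<^sup>+ x. ennreal (C powr r) * indicator (away p S k) x \<partial>M) < \<infinity>"
      using M_away[of k] by (simp add: nn_integral_cmult ennreal_mult_less_top)
    show "AE x in M. ennreal (f j x powr r) \<le> ennreal (C powr r) * indicator (away p S k) x" for j
    proof (rule AE_I2)
      fix x
      have "f j x powr r \<le> C powr r" using F(1,2)[of j x] r_pos by (intro powr_mono2) auto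
      then show "ennreal (f j x powr r) \<le> ennreal (C powr r) * indicator (away p S k) x"
        using F(3)[of x j] by (cases "x \<in> away p S k") (auto intro: ennreal_leI)
    qed
    show "AE x in M. (\<lambda>j. ennreal (f j x powr r)) \<longlonglongrightarrow> ennreal (h x powr r)"
      using F(1) lim r_pos by (intro AE_I2 tendsto_ennrealI tendsto_powr') auto
  qed auto
  ultimately show ?thesis
    by (intro LIMSEQ_le[OF ennreal_tendsto_cmult tendsto_add[OF tendsto_const ennreal_tendsto_cmult]])
      (use test_bound[OF f] in \<open>auto simp: less_top[symmetric]\<close>)
qed

text \<open>Each \<open>A i\<close> is replaced by a compact subset of \<open>A i - S\<close> that
  loses at most \<open>1 / real (Suc n)\<close> of its \<open>\<nu>\<close>-mass. For
  \<open>M\<close>, monotonicity suffices, because the sets only shrink on the larger side of the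
  inequality.\<close>

lemma simple_bound:
  fixes A :: "'i \<Rightarrow> 'a set" and b :: "'i \<Rightarrow> real"
  assumes I: "finite I" and b: "\<And>i. i \<in> I \<Longrightarrow> 0 \<le> b i"
    and A: "\<And>i. i \<in> I \<Longrightarrow> A i \<in> sets borel" and disj: "disjoint_family_on A I"
  shows "ennreal q * (\<Sum>i\<in>I. ennreal (b i) * emeasure \<nu> (A i)) \<le>
    L + ennreal (q - 1) * (\<Sum>i\<in>I. ennreal (b i powr r) * emeasure M (A i))"
proof -
  have "\<exists>K. \<forall>n. compact (K n) \<and> K n \<subseteq> A i - S \<and> emeasure \<nu> (A i) \<le> emeasure \<nu> (K n) + ennreal (1 / real (Suc n))"
    if "i \<in> I" for i
  proof -
    have *: "A i - S \<in> sets borel" using A[OF that] closed_S by auto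
    have AS: "emeasure \<nu> (A i - S) = emeasure \<nu> (A i)"
      using A[OF that] closed_S \<nu>_S by (intro emeasure_Diff_null_set) (auto simp: null_sets_def)
    have "\<exists>K. compact K \<and> K \<subseteq> A i - S \<and> emeasure \<nu> (A i) \<le> emeasure \<nu> K + ennreal (1 / real (Suc n))" for n
    \<comment> \<open>Positive measure makes the inequality below strict even if the difference is
      negative and \<open>ennreal\<close> truncates it to 0; a null set is approximated by the empty
      set.\<close>
    proof (cases "measure \<nu> (A i) = 0")
      case True
      then show ?thesis by (intro exI[of _ "{}"]) (simp add: \<nu>.emeasure_eq_measure)
    next
      case False
      then have pos: "0 < measure \<nu> (A i)" using zero_less_measure_iff by blast
      have "ennreal (measure \<nu> (A i) - 1 / real (Suc n)) < emeasure \<nu> (A i)"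
        using pos unfolding \<nu>.emeasure_eq_measure by (intro ennreal_lessI) auto
      also have "emeasure \<nu> (A i) = (SUP K\<in>{K. K \<subseteq> A i - S \<and> compact K}. emeasure \<nu> K)"
        unfolding AS[symmetric] by (rule inner_regular) (use * in auto)
      finally obtain K where K: "compact K" "K \<subseteq> A i - S"
        "ennreal (measure \<nu> (A i) - 1 / real (Suc n)) < ennreal (measure \<nu> K)"
        unfolding less_SUP_iff \<nu>.emeasure_eq_measure by blast
      have "measure \<nu> (A i) - 1 / real (Suc n) \<le> measure \<nu> K"
        by (rule ccontr) (use K(3) in \<open>auto simp: not_le dest!: less_imp_le[THEN ennreal_leI]\<close>)
      then have "ennreal (measure \<nu> (A i)) \<le> ennreal (measure \<nu> K + 1 / real (Suc n))"
        by (intro ennreal_leI) linarith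
      then show ?thesis
        using K(1,2) by (intro exI[of _ K]) (simp add: \<nu>.emeasure_eq_measure)
    qed
    then show ?thesis by metis
  qed
  then obtain K where K: "\<And>i n. i \<in> I \<Longrightarrow> compact (K i n)" "\<And>i n. i \<in> I \<Longrightarrow> K i n \<subseteq> A i - S"
    "\<And>i n. i \<in> I \<Longrightarrow> emeasure \<nu> (A i) \<le> emeasure \<nu> (K i n) + ennreal (1 / real (Suc n))"
    by metis
  have Km: "K i n \<in> sets borel" if "i \<in> I" for i n
    using K(1)[OF that] by (auto intro: borel_closed compact_imp_closed)
  let ?R = "L + ennreal (q - 1) * (\<Sum>i\<in>I. ennreal (b i powr r) * emeasure M (A i))"
  have *: "ennreal q * (\<Sum>i\<in>I. ennreal (b i) * emeasure \<nu> (A i)) \<le>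
    ?R + ennreal q * (\<Sum>i\<in>I. ennreal (b i) * ennreal (1 / real (Suc n)))" for n
  proof -
    define h where "h x = (\<Sum>i\<in>I. b i * indicator (K i n) x)" for x
    have "approx_by_tests p S h" unfolding h_def
      using K b I closed_S by (intro approx_by_tests_sum) (auto, blast+)
    then have bd: "ennreal q * (\<integral>\<^sup>+x. ennreal (h x) \<partial>\<nu>) \<le> L + ennreal (q - 1) * (\<integral>\<^sup>+x. ennreal (h x powr r) \<partial>M)"
      by (rule approx_bound)
    have "ennreal (h x) = (\<Sum>i\<in>I. ennreal (b i) * indicator (K i n) x)" for x
    proof -
      have "ennreal (h x) = (\<Sum>i\<in>I. ennreal (b i * indicator (K i n) x))"
        unfolding h_def using b by (intro sum_ennreal[symmetric]) auto
      also have "\<dots> = (\<Sum>i\<in>I. ennreal (b i) * indicator (K i n) x)"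
        by (intro sum.cong) (auto simp: indicator_def)
      finally show ?thesis .
    qed
    then have h\<nu>: "(\<integral>\<^sup>+x. ennreal (h x) \<partial>\<nu>) = (\<Sum>i\<in>I. ennreal (b i) * emeasure \<nu> (K i n))"
      using Km by (simp add: nn_integral_sum nn_integral_cmult)
    \<comment> \<open>By disjointness at most one summand of \<open>h x\<close> is nonzero, so the
      power of the sum is a single power.\<close>
    have "ennreal (h x powr r) \<le> (\<Sum>i\<in>I. ennreal (b i powr r) * indicator (A i) x)" for x
    proof (cases "\<exists>i\<in>I. x \<in> K i n")
      case True
      then obtain i where i: "i \<in> I" "x \<in> K i n" by blast
      have "x \<notin> K j n" if "j \<in> I - {i}" for j
        using K(2)[of i n] K(2)[of j n] i that disj unfolding disjoint_family_on_def by blast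
      then have "h x = b i"
        unfolding h_def using I i by (subst sum.remove[OF I i(1)]) (simp del: sum_mult_indicator)
      then have "ennreal (h x powr r) = ennreal (b i powr r) * indicator (A i) x"
        using K(2)[of i n] i by auto
      also have "\<dots> \<le> (\<Sum>i\<in>I. ennreal (b i powr r) * indicator (A i) x)"
        by (rule member_le_sum) (use I i in auto)
      finally show ?thesis .
    next
      case False
      then have "h x = 0" unfolding h_def by (intro sum.neutral) auto
      then show ?thesis by simp
    qed
    then have "(\<integral>\<^sup>+x. ennreal (h x powr r) \<partial>M) \<le> (\<integral>\<^sup>+x. (\<Sum>i\<in>I. ennreal (b i powr r) * indicator (A i) x) \<partial>M)"
      by (intro nn_integral_mono)
    also have "\<dots> = (\<Sum>i\<in>I. ennreal (b i powr r) * emeasure M (A i))"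
      using A by (simp add: nn_integral_sum nn_integral_cmult)
    finally have hM: "(\<integral>\<^sup>+x. ennreal (h x powr r) \<partial>M) \<le> (\<Sum>i\<in>I. ennreal (b i powr r) * emeasure M (A i))" .
    have "(\<Sum>i\<in>I. ennreal (b i) * emeasure \<nu> (A i)) \<le>
      (\<Sum>i\<in>I. ennreal (b i) * (emeasure \<nu> (K i n) + ennreal (1 / real (Suc n))))"
      using K(3) by (intro sum_mono mult_left_mono) auto
    then have "ennreal q * (\<Sum>i\<in>I. ennreal (b i) * emeasure \<nu> (A i)) \<le>
      ennreal q * (\<integral>\<^sup>+x. ennreal (h x) \<partial>\<nu>) + ennreal q * (\<Sum>i\<in>I. ennreal (b i) * ennreal (1 / real (Suc n)))"
      unfolding h\<nu> distrib_left[symmetric] by (intro mult_left_mono) (auto simp: distrib_left sum.distrib)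
    also have "\<dots> \<le> ?R + ennreal q * (\<Sum>i\<in>I. ennreal (b i) * ennreal (1 / real (Suc n)))"
      by (intro add_right_mono order_trans[OF bd] add_left_mono mult_left_mono hM) auto
    finally show ?thesis .
  qed
  \<comment> \<open>The loss from inner regularity is a finite sum of terms tending to 0, while
    \<open>?R\<close> does not depend on \<open>n\<close>.\<close>
  have "(\<lambda>n. ?R + ennreal q * (\<Sum>i\<in>I. ennreal (b i) * ennreal (1 / real (Suc n)))) \<longlonglongrightarrow>
     ?R + ennreal q * (\<Sum>i\<in>I. ennreal (b i) * 0)"
  proof -
    have "(\<lambda>n. ennreal (1 / real (Suc n))) \<longlonglongrightarrow> ennreal 0"
      by (intro tendsto_ennrealI LIMSEQ_Suc lim_1_over_n)
    then show ?thesis by (intro tendsto_add tendsto_const ennreal_tendsto_cmult tendsto_sum) auto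
  qed
  from LIMSEQ_le_const[OF this] * show ?thesis by auto
qed

text \<open>The level sets of a simple function are disjoint, so \<open>simple_bound\<close> applies
  to simple functions increasing to \<open>g\<close>. Monotone convergence handles the left side; on
  the right each power is dominated by \<open>g x powr r\<close>.\<close>

lemma borel_bound:
  fixes g :: "'a \<Rightarrow> real"
  assumes [measurable]: "g \<in> borel_measurable borel" and "\<And>x. 0 \<le> g x"
  shows "ennreal q * (\<integral>\<^sup>+x. ennreal (g x) \<partial>\<nu>) \<le> L + ennreal (q - 1) * (\<integral>\<^sup>+x. ennreal (g x powr r) \<partial>M)"
proof -
  obtain u where u: "\<And>i. simple_function borel (u i)" "incseq u" "\<And>i x. u i x < top"
    "\<And>x. (SUP i. u i x) = ennreal (g x)"
    using borel_measurable_implies_simple_function_sequence'[of "\<lambda>x. ennreal (g x)" borel] by auto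
  have [measurable]: "u i \<in> borel_measurable borel" for i
    using u(1) by (rule borel_measurable_simple_function)
  have "ennreal q * (\<integral>\<^sup>+x. u i x \<partial>\<nu>) \<le> L + ennreal (q - 1) * (\<integral>\<^sup>+x. ennreal (g x powr r) \<partial>M)" for i
  proof -
    let ?I = "range (u i)" and ?A = "\<lambda>y. u i -` {y}" and ?b = enn2real
    have sf: "simple_function \<nu> (u i)" "simple_function M (u i)"
      using u(1)[of i] by (auto simp: simple_function_def space_M space_\<nu>)
    have fin: "finite ?I" using u(1)[of i] by (simp add: simple_function_def)
    have eq: "ennreal (?b y) = y" if "y \<in> ?I" for y
      using that u(3)[of i] by auto
    have Am: "?A y \<in> sets borel" for y
      using measurable_sets[of "u i" borel borel "{y}"] by simp
    have "(\<integral>\<^sup>+x. u i x \<partial>\<nu>) = (\<Sum>y\<in>?I. ennreal (?b y) * emeasure \<nu> (?A y))"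
      unfolding nn_integral_eq_simple_integral[OF sf(1)] simple_integral_def space_\<nu>
      by (intro sum.cong) (auto simp: eq)
    then have "ennreal q * (\<integral>\<^sup>+x. u i x \<partial>\<nu>) \<le>
      L + ennreal (q - 1) * (\<Sum>y\<in>?I. ennreal (?b y powr r) * emeasure M (?A y))"
      using simple_bound[of ?I ?b ?A] fin Am
      unfolding disjoint_family_on_def by fastforce
    also have "(\<Sum>y\<in>?I. ennreal (?b y powr r) * emeasure M (?A y)) =
      (\<integral>\<^sup>+x. (\<Sum>y\<in>?I. ennreal (?b y powr r) * indicator (?A y) x) \<partial>M)"
      using Am by (simp add: nn_integral_sum nn_integral_cmult)
    also have "\<dots> = (\<integral>\<^sup>+x. ennreal (?b (u i x) powr r) \<partial>M)"
    proof (rule nn_integral_cong)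
      fix x
      show "(\<Sum>y\<in>?I. ennreal (?b y powr r) * indicator (?A y) x) = ennreal (?b (u i x) powr r)"
        by (subst sum.remove[OF fin, of "u i x"]) (auto intro!: sum.neutral simp: indicator_def)
    qed
    also have "\<dots> \<le> (\<integral>\<^sup>+x. ennreal (g x powr r) \<partial>M)"
    proof (rule nn_integral_mono)
      fix x
      have "u i x \<le> ennreal (g x)" unfolding u(4)[symmetric] by (rule SUP_upper) simp
      then have "?b (u i x) \<le> g x" using assms(2)[of x] enn2real_mono by fastforce
      then show "ennreal (?b (u i x) powr r) \<le> ennreal (g x powr r)"
        using r_pos by (intro ennreal_leI powr_mono2) auto
    qed
    finally show ?thesis by (simp add: add_left_mono mult_left_mono)
  qed
  moreover have "(\<integral>\<^sup>+x. ennreal (g x) \<partial>\<nu>) = (SUP i. \<integral>\<^sup>+x. u i x \<partial>\<nu>)"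
    unfolding u(4)[symmetric] using u(2) by (intro nn_integral_monotone_convergence_SUP) auto
  ultimately show ?thesis by (simp add: SUP_mult_left_ennreal SUP_least)
qed

section \<open>Absolute continuity and the entropy bound for the limit\<close>

lemma absolutely_continuous:
  assumes "L < \<infinity>" shows "absolutely_continuous M \<nu>"
  unfolding absolutely_continuous_def
proof
  fix A assume "A \<in> null_sets M"
  then have A: "A \<in> sets borel" "emeasure M A = 0" by auto
  \<comment> \<open>For multiples of the indicator of \<open>A\<close> the \<open>M\<close>-integral
    vanishes, which leaves a bound uniform in \<open>c\<close>.\<close>
  have *: "ennreal q * (ennreal c * emeasure \<nu> A) \<le> L" if "c \<ge> 0" for c
  proof -
    have "(\<integral>\<^sup>+x. ennreal ((c * indicator A x) powr r) \<partial>M) = (\<integral>\<^sup>+x. ennreal (c powr r) * indicator A x \<partial>M)"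
      using r_pos by (intro nn_integral_cong) (auto simp: indicator_def)
    moreover have "(\<integral>\<^sup>+x. ennreal (c * indicator A x) \<partial>\<nu>) = (\<integral>\<^sup>+x. ennreal c * indicator A x \<partial>\<nu>)"
      by (intro nn_integral_cong) (auto simp: indicator_def)
    ultimately show ?thesis
      using borel_bound[of "\<lambda>x. c * indicator A x"] A that by (simp add: nn_integral_cmult)
  qed
  obtain l where l: "L = ennreal l" "l \<ge> 0" using assms by (cases L) auto
  have "measure \<nu> A = 0"
  proof (rule ccontr)
    assume "measure \<nu> A \<noteq> 0"
    then have pos: "0 < measure \<nu> A" using zero_less_measure_iff by blast
    \<comment> \<open>This multiple turns the bound into \<open>q * (l + 1) \<le> l\<close>,
      impossible for \<open>q > 1\<close> and \<open>l \<ge> 0\<close>.\<close>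
    let ?c = "(l + 1) / measure \<nu> A"
    have "ennreal q * (ennreal ?c * emeasure \<nu> A) = ennreal (q * (l + 1))"
      using l q pos by (simp add: \<nu>.emeasure_eq_measure del: ennreal_plus flip: ennreal_mult)
    then have "q * (l + 1) \<le> l"
      using *[of ?c] l q pos by (simp add: ennreal_le_iff)
    moreover have "l + 1 \<le> q * (l + 1)" using mult_right_mono[of 1 q "l + 1"] q l by simp
    ultimately show False by (simp del: mult_le_cancel_right1)
  qed
  then show "A \<in> null_sets \<nu>" using A by (auto simp: \<nu>.emeasure_eq_measure)
qed

text \<open>The dual bound is tested on truncations, because the term \<open>(q - 1) * ?J\<close>
  can be cancelled only when \<open>?J\<close> is finite. Monotone convergence then removes the
  truncation.\<close>

lemma entropy_le:
  assumes "L < \<infinity>"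
  shows "(\<integral>\<^sup>+x. ennreal (enn2real (RN_deriv M \<nu> x) powr q) \<partial>M) \<le> L"
proof -
  note ac = absolutely_continuous[OF assms]
  let ?\<rho> = "RN_deriv M \<nu>"
  define \<rho> where "\<rho> x = enn2real (?\<rho> x)" for x
  have [measurable]: "\<rho> \<in> borel_measurable borel"
    unfolding \<rho>_def using borel_measurable_RN_deriv[of M \<nu>] by simp
  have \<rho>0: "0 \<le> \<rho> x" for x by (simp add: \<rho>_def)
  have fin: "AE x in M. ?\<rho> x \<noteq> \<infinity>"
    using ac by (intro M.RN_deriv_finite) (auto intro: \<nu>.sigma_finite_measure_axioms)
  obtain B :: "nat \<Rightarrow> 'a set" where B: "range B \<subseteq> sets M" "(\<Union>i. B i) = space M"
    "\<And>i. emeasure M (B i) \<noteq> \<infinity>" "incseq B"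
    using M.sigma_finite_incseq by blast
  \<comment> \<open>The finite mass of \<open>B i\<close> and the bound \<open>real i\<close> on the
    density together make the truncated entropy finite.\<close>
  define E where "E i = {x \<in> B i. \<rho> x \<le> real i}" for i
  have Bm [measurable]: "B i \<in> sets borel" for i using B(1) by auto
  have [measurable]: "E i \<in> sets borel" for i
    unfolding E_def by measurable
  have E_inc: "incseq E"
    using B(4) unfolding E_def incseq_def by (auto intro: order_trans)
  have E_Un: "(\<Union>i. E i) = UNIV"
  proof (intro equalityI subset_UNIV subsetI)
    fix x
    obtain i where i: "x \<in> B i" using B(2) space_M by auto
    obtain j :: nat where j: "\<rho> x \<le> real j" using real_arch_simple by blast
    have "x \<in> B (max i j)" using i B(4) by (meson incseqD max.cobounded1 subsetD)
    then have "x \<in> E (max i j)" using j by (auto simp: E_def)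
    then show "x \<in> (\<Union>i. E i)" by blast
  qed
  have E_bound: "(\<integral>\<^sup>+x. ennreal (\<rho> x powr q) * indicator (E i) x \<partial>M) \<le> L" for i
  proof -
    \<comment> \<open>Both \<open>\<rho> x * \<rho> x powr (q - 1)\<close> and
      \<open>(\<rho> x powr (q - 1)) powr r\<close> equal \<open>\<rho> x powr q\<close>, so both
      integrals in the dual bound become \<open>?J\<close>.\<close>
    define g where "g x = \<rho> x powr (q - 1) * indicator (E i) x" for x
    have [measurable]: "g \<in> borel_measurable borel" unfolding g_def by measurable
    let ?J = "\<integral>\<^sup>+x. ennreal (\<rho> x powr q) * indicator (E i) x \<partial>M"
    have "?J \<le> (\<integral>\<^sup>+x. ennreal (real i powr q) * indicator (B i) x \<partial>M)"
      using \<rho>0 q by (intro nn_integral_mono) (auto simp: E_def indicator_def intro!: ennreal_leI powr_mono2)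
    also have "\<dots> < \<infinity>"
      using B(3)[of i] by (simp add: nn_integral_cmult ennreal_mult_less_top less_top)
    finally have J: "?J < \<infinity>" .
    have "(\<integral>\<^sup>+x. ennreal (g x) \<partial>\<nu>) = (\<integral>\<^sup>+x. ?\<rho> x * ennreal (g x) \<partial>M)"
      using ac by (intro M.RN_deriv_nn_integral) auto
    also have "\<dots> = ?J"
    proof (rule nn_integral_cong_AE, use fin in eventually_elim)
      fix x assume "?\<rho> x \<noteq> \<infinity>"
      then have "?\<rho> x = ennreal (\<rho> x)" by (simp add: \<rho>_def less_top)
      moreover have "\<rho> x * \<rho> x powr (q - 1) = \<rho> x powr q"
        using \<rho>0[of x] q by (cases "\<rho> x = 0") (simp_all add: powr_mult_base)
      ultimately show "?\<rho> x * ennreal (g x) = ennreal (\<rho> x powr q) * indicator (E i) x"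
        using \<rho>0[of x] by (auto simp: g_def indicator_def simp flip: ennreal_mult)
    qed
    finally have 1: "(\<integral>\<^sup>+x. ennreal (g x) \<partial>\<nu>) = ?J" .
    have 2: "(\<integral>\<^sup>+x. ennreal (g x powr r) \<partial>M) = ?J"
    proof (rule nn_integral_cong)
      fix x
      have "(q - 1) * r = q" using q r by simp
      then show "ennreal (g x powr r) = ennreal (\<rho> x powr q) * indicator (E i) x"
        using r_pos by (auto simp: g_def indicator_def powr_powr)
    qed
    have "ennreal q * ?J \<le> L + ennreal (q - 1) * ?J"
      using borel_bound[of g] unfolding 1 2 by (auto simp: g_def)
    \<comment> \<open>With \<open>?J\<close> and \<open>L\<close> finite the inequality can be read
      in the reals, where \<open>(q - 1) * a\<close> may be subtracted.\<close>
    moreover obtain a where a: "?J = ennreal a" "0 \<le> a" using J by (cases ?J) auto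
    moreover obtain l where l: "L = ennreal l" "0 \<le> l" using assms by (cases L) auto
    ultimately have "q * a \<le> l + (q - 1) * a"
      using q by (simp add: ennreal_le_iff flip: ennreal_mult ennreal_plus)
    then show ?thesis using a l by (simp add: algebra_simps)
  qed
  have "(\<integral>\<^sup>+x. ennreal (\<rho> x powr q) \<partial>M) = (\<integral>\<^sup>+x. (SUP i. ennreal (\<rho> x powr q) * indicator (E i) x) \<partial>M)"
  proof (rule nn_integral_cong)
    fix x
    obtain i where "x \<in> E i" using E_Un by auto
    show "ennreal (\<rho> x powr q) = (SUP i. ennreal (\<rho> x powr q) * indicator (E i) x)"
      using \<open>x \<in> E i\<close>
      by (intro antisym SUP_least SUP_upper2[of i]) (auto simp: indicator_def)
  qed
  also have "\<dots> = (SUP i. \<integral>\<^sup>+x. ennreal (\<rho> x powr q) * indicator (E i) x \<partial>M)"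
  proof (intro nn_integral_monotone_convergence_SUP)
    show "incseq (\<lambda>i x. ennreal (\<rho> x powr q) * indicator (E i) x)"
      using E_inc by (auto simp: incseq_def le_fun_def indicator_def)
  qed auto
  also have "\<dots> \<le> L" using E_bound by (intro SUP_least)
  finally show ?thesis by (simp add: \<rho>_def)
qed

end

section \<open>Lower semicontinuity\<close>

lemma measures_off_sets:
  assumes "m \<in> measures_off S"
  shows "space m = UNIV" "sets borel \<subseteq> sets m" "(\<lambda>x. x) \<in> measurable m borel"
proof -
  show 1: "space m = UNIV"
    using assms by (simp add: measures_off_def quasi_radon_measure_def)
  have "borel_on m"
    using assms by (simp add: measures_off_def quasi_radon_measure_def)
  then show 2: "sets borel \<subseteq> sets m"
    by (simp add: borel_on_def 1 sets_restrict_space)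
  show "(\<lambda>x. x) \<in> measurable m borel"
    using 1 2 by (auto intro!: measurableI)
qed

lemma sets_borel_part [simp]: "sets (borel_part m) = sets borel"
  by (simp add: borel_part_def)

lemma emeasure_borel_part:
  assumes "m \<in> measures_off S" "A \<in> sets borel"
  shows "emeasure (borel_part m) A = emeasure m A"
  using measures_off_sets[OF assms(1)] assms(2) by (simp add: borel_part_def emeasure_distr)

lemma nn_integral_borel_part:
  assumes "m \<in> measures_off S" "f \<in> borel_measurable borel"
  shows "(\<integral>\<^sup>+x. f x \<partial>borel_part m) = (\<integral>\<^sup>+x. f x \<partial>m)"
  using measures_off_sets[OF assms(1)] assms(2) by (simp add: borel_part_def nn_integral_distr)

lemma integral_borel_part:
  fixes f :: "'a::metric_space \<Rightarrow> real"
  assumes "m \<in> measures_off S" "f \<in> borel_measurable borel"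
  shows "integral\<^sup>L (borel_part m) f = integral\<^sup>L m f"
  using measures_off_sets[OF assms(1)] assms(2) by (simp add: borel_part_def integral_distr)

text \<open>The complement of \<open>away p S k\<close> is a neighbourhood of \<open>S\<close>, so
  the subspace measure on this bounded set is finite by the definition of
  \<open>measures_off\<close>.\<close>

lemma borel_part_away_finite:
  assumes "m \<in> measures_off S"
  shows "emeasure (borel_part m) (away p S k) < \<infinity>"
proof -
  have b: "away p S k \<in> sets borel" by (rule borel_closed[OF closed_away])
  have "\<forall>B\<in>sets (restrict_space m (- (- away p S k))). bounded B \<longrightarrow>
      emeasure (restrict_space m (- (- away p S k))) B < \<infinity>"
    using assms nbhd_away[of S p k] unfolding measures_off_def by blast
  moreover have "away p S k \<in> sets (restrict_space m (away p S k))"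
    using b measures_off_sets[OF assms] by (auto simp: sets_restrict_space)
  ultimately have "emeasure (restrict_space m (away p S k)) (away p S k) < \<infinity>"
    using bounded_away[of p S k] by simp
  then show ?thesis
    using b measures_off_sets[OF assms]
    by (subst (asm) emeasure_restrict_space) (auto simp: emeasure_borel_part[OF assms])
qed

lemma borel_part_sing:
  assumes "m \<in> measures_off S" "closed S"
  shows "emeasure (borel_part m) S = 0"
proof -
  have "emeasure m S = 0" using assms by (simp add: measures_off_def)
  then show ?thesis using assms by (simp add: emeasure_borel_part)
qed

lemma sigma_finite_borel_part:
  assumes "m \<in> measures_off S" "closed S"
  shows "sigma_finite_measure (borel_part m)"
  using sigma_finite_away[OF sets_borel_part assms(2) borel_part_sing[OF assms]
      borel_part_away_finite[OF assms(1)]] .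

text \<open>The hypothesis on the reference measures concerns Bochner integrals, the dual bound
  nonnegative ones. They agree because domination by a multiple of the indicator of
  \<open>away p S k\<close> gives integrability, which rules out the default value 0.\<close>

lemma nn_integral_powr_test_fun:
  assumes m: "m \<in> measures_off S" and f: "test_fun p S k C f" and "0 < r"
  shows "(\<integral>\<^sup>+x. ennreal (f x powr r) \<partial>borel_part m) = ennreal (\<integral>x. f x powr r \<partial>m)"
proof -
  have [measurable]: "f \<in> borel_measurable borel" by (rule test_fun_measurable[OF f])
  have fm: "f \<in> borel_measurable (borel_part m)"
    by (simp add: measurable_cong_sets[OF sets_borel_part refl])
  have [measurable]: "away p S k \<in> sets (borel_part m)"
    by (simp add: borel_closed[OF closed_away])
  have F: "\<And>x. 0 \<le> f x" "\<And>x. f x \<le> C" "\<And>x. x \<notin> away p S k \<Longrightarrow> f x = 0"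
    using f by (auto simp: test_fun_def)
  have "integrable (borel_part m) (\<lambda>x. f x powr r)"
  proof (rule Bochner_Integration.integrable_bound)
    show "integrable (borel_part m) (\<lambda>x. C powr r * indicator (away p S k) x)"
      using borel_part_away_finite[OF m]
      by (intro integrable_mult_right integrable_real_indicator) (auto simp: borel_closed[OF closed_away])
    show "(\<lambda>x. f x powr r) \<in> borel_measurable (borel_part m)" using fm by measurable
    have "f x powr r \<le> C powr r * indicator (away p S k) x" for x
      using F[of x] \<open>0 < r\<close> by (cases "x \<in> away p S k") (auto intro: powr_mono2)
    then show "AE x in borel_part m. norm (f x powr r) \<le> norm (C powr r * indicator (away p S k) x)"
      by (intro AE_I2) simp
  qed
  then have "(\<integral>\<^sup>+x. ennreal (f x powr r) \<partial>borel_part m) = ennreal (\<integral>x. f x powr r \<partial>borel_part m)"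
    by (intro nn_integral_eq_integral) auto
  then show ?thesis by (subst (asm) integral_borel_part[OF m]) auto
qed

lemma nn_integral_test_fun_prob:
  assumes \<nu>: "prob_space \<nu>" "sets \<nu> = sets borel" and f: "test_fun p S k C f"
  shows "(\<integral>\<^sup>+x. ennreal (f x) \<partial>\<nu>) = ennreal (integral\<^sup>L \<nu> f)"
proof -
  interpret prob_space \<nu> by fact
  have "f \<in> borel_measurable \<nu>"
    using test_fun_measurable[OF f] by (simp add: measurable_cong_sets[OF \<nu>(2) refl])
  then have "integrable \<nu> f"
    using f by (intro integrable_const_bound[where B=C]) (auto simp: test_fun_def)
  then show ?thesis
    using f by (intro nn_integral_eq_integral) (auto simp: test_fun_def)
qed

section \<open>The dual bound for a single pair of measures\<close>

lemma renyi_entropy_borel_part: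
  assumes "m \<in> measures_off S" "absolutely_continuous (borel_part m) \<mu>"
  shows "renyi_entropy N m \<mu> =
    (\<integral>\<^sup>+x. ennreal (enn2real (RN_deriv (borel_part m) \<mu> x) powr ((N - 1) / N)) \<partial>borel_part m)"
proof -
  have "RN_deriv (borel_part m) \<mu> \<in> borel_measurable borel"
    using borel_measurable_RN_deriv[of "borel_part m" \<mu>]
    by (simp add: measurable_cong_sets[OF sets_borel_part refl])
  then show ?thesis
    using assms(2) by (simp add: renyi_entropy_def nn_integral_borel_part[OF assms(1)])
qed

text \<open>This is the integrated Young inequality with real integrals, the form in which limits
  are taken. Without absolute continuity the entropy is infinite and the bound is trivial.\<close>

lemma renyi_entropy_test_bound:
  assumes m: "m \<in> measures_off S" and "closed S"
    and \<mu>: "prob_space \<mu>" "sets \<mu> = sets borel" and f: "test_fun p S k C f"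
    and q: "q = (N - 1) / N" "1 < q" and r: "r = q / (q - 1)"
  shows "ennreal (q * integral\<^sup>L \<mu> f) \<le>
    renyi_entropy N m \<mu> + ennreal ((q - 1) * (\<integral>x. f x powr r \<partial>m))"
proof (cases "absolutely_continuous (borel_part m) \<mu>")
  case True
  interpret \<mu>: prob_space \<mu> by fact
  have F: "\<And>x. 0 \<le> f x" using f by (auto simp: test_fun_def)
  have "0 < r" using q(2) unfolding r by simp
  have fm: "f \<in> borel_measurable (borel_part m)"
    using test_fun_measurable[OF f] by (simp add: measurable_cong_sets[OF sets_borel_part refl])
  have "ennreal q * (\<integral>\<^sup>+x. ennreal (f x) \<partial>\<mu>) \<le> renyi_entropy N m \<mu> +
    ennreal (q - 1) * (\<integral>\<^sup>+x. ennreal (f x powr r) \<partial>borel_part m)"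
    unfolding renyi_entropy_borel_part[OF m True] q(1)[symmetric]
    using assms True F fm sigma_finite_borel_part[OF m \<open>closed S\<close>]
    by (intro nn_integral_young_RN_deriv) (auto intro: \<mu>.sigma_finite_measure_axioms)
  then show ?thesis
    unfolding nn_integral_powr_test_fun[OF m f \<open>0 < r\<close>] nn_integral_test_fun_prob[OF \<mu> f]
    using q(2) F by (simp add: ennreal_mult)
qed (simp add: renyi_entropy_def)

text \<open>Assumption \<open>\<mu>_conv\<close> concerns bounded Lipschitz functions only, so that
  weak convergence and \<open>W2\<close>-convergence can both be fed into it.\<close>

proposition renyi_entropy_lsc:
  fixes S :: "'a::polish_space set"
  assumes "N < 0" "closed S"
    and m: "\<And>n. m n \<in> measures_off S" "m_lim \<in> measures_off S"
    and \<mu>: "\<And>n. \<mu> n \<in> P2_off p S" "\<mu>_lim \<in> P2_off p S"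
    and m_conv: "weak_star_conv_off S m m_lim"
    and \<mu>_conv: "\<And>L f. L-lipschitz_on UNIV f \<Longrightarrow> bounded (range f) \<Longrightarrow>
      (\<lambda>n. integral\<^sup>L (\<mu> n) f) \<longlonglongrightarrow> integral\<^sup>L \<mu>_lim (f :: 'a \<Rightarrow> real)"
  shows "renyi_entropy N m_lim \<mu>_lim \<le> liminf (\<lambda>n. renyi_entropy N (m n) (\<mu> n))"
proof -
  define q where "q = (N - 1) / N"
  define r where "r = q / (q - 1)"
  have q: "1 < q" using \<open>N < 0\<close> by (simp add: q_def field_simps)
  then have "0 < r" by (simp add: r_def)
  have prob: "\<And>n. prob_space (\<mu> n)" "prob_space \<mu>_lim" "\<And>n. sets (\<mu> n) = sets borel"
    "sets \<mu>_lim = sets borel" "emeasure \<mu>_lim S = 0"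
    using \<mu> by (auto simp: P2_off_def P2_def)
  let ?R = "\<lambda>n. renyi_entropy N (m n) (\<mu> n)"
  have bound: "ennreal q * (\<integral>\<^sup>+x. ennreal (f x) \<partial>\<mu>_lim) \<le>
    liminf ?R + ennreal (q - 1) * (\<integral>\<^sup>+x. ennreal (f x powr r) \<partial>borel_part m_lim)"
    if f: "test_fun p S k C f" for k C f
  proof -
    have F: "\<And>x. 0 \<le> f x" "\<And>x. f x \<le> C" using f by (auto simp: test_fun_def)
    \<comment> \<open>Along a subsequence realising the lower limit, all three terms of the test
      bound converge.\<close>
    obtain s where s: "strict_mono s" "(?R \<circ> s) \<longlonglongrightarrow> liminf ?R"
      using liminf_subseq_lim by blast
    have bdd: "bounded (range f)" using F by (intro boundedI[where B=C]) auto
    have "(\<lambda>n. integral\<^sup>L (\<mu> n) f) \<longlonglongrightarrow> integral\<^sup>L \<mu>_lim f"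
      using f \<mu>_conv[OF _ bdd] by (auto simp: test_fun_def)
    then have 1: "(\<lambda>n. ennreal (q * integral\<^sup>L (\<mu> (s n)) f)) \<longlonglongrightarrow> ennreal (q * integral\<^sup>L \<mu>_lim f)"
      using s(1) by (intro tendsto_ennrealI tendsto_mult_left)
        (auto dest: LIMSEQ_subseq_LIMSEQ[where f=s] simp: o_def)
    have "(\<lambda>n. \<integral>x. f x powr r \<partial>m n) \<longlonglongrightarrow> (\<integral>x. f x powr r \<partial>m_lim)"
      using m_conv powr_test_fun_in_C[OF f \<open>0 < r\<close>] by (simp add: weak_star_conv_off_def)
    then have "(\<lambda>n. ennreal ((q - 1) * (\<integral>x. f x powr r \<partial>m (s n)))) \<longlonglongrightarrow> ennreal ((q - 1) * (\<integral>x. f x powr r \<partial>m_lim))"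
      using s(1) by (intro tendsto_ennrealI tendsto_mult_left)
        (auto dest: LIMSEQ_subseq_LIMSEQ[where f=s] simp: o_def)
    with s(2) have "(\<lambda>n. ?R (s n) + ennreal ((q - 1) * (\<integral>x. f x powr r \<partial>m (s n)))) \<longlonglongrightarrow>
      liminf ?R + ennreal ((q - 1) * (\<integral>x. f x powr r \<partial>m_lim))"
      by (intro tendsto_add) (simp_all add: o_def)
    with 1 have "ennreal (q * integral\<^sup>L \<mu>_lim f) \<le> liminf ?R + ennreal ((q - 1) * (\<integral>x. f x powr r \<partial>m_lim))"
      by (rule LIMSEQ_le)
        (auto intro!: exI[of _ 0] renyi_entropy_test_bound[OF m(1) \<open>closed S\<close> prob(1,3) f q_def q r_def])
    then show ?thesis
      unfolding nn_integral_powr_test_fun[OF m(2) f \<open>0 < r\<close>] nn_integral_test_fun_prob[OF prob(2,4) f]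
      using q F by (simp add: ennreal_mult)
  qed
  show ?thesis
  proof (cases "liminf ?R = \<infinity>")
    case False
    then have fin: "liminf ?R < \<infinity>" by (simp add: less_top)
    \<comment> \<open>The limit pair satisfies the dual bound with the lower limit as
      \<open>L\<close>; its finiteness is what the two conclusions of the locale require.\<close>
    interpret renyi_dual_bound p S "borel_part m_lim" \<mu>_lim q r "liminf ?R"
      by (rule renyi_dual_bound.intro[OF assms(2) sets_borel_part prob(4,2)
          borel_part_sing[OF m(2) assms(2)] prob(5) borel_part_away_finite[OF m(2)] q r_def bound])
    show ?thesis
      unfolding renyi_entropy_borel_part[OF m(2) absolutely_continuous[OF fin]] q_def[symmetric]
      by (rule entropy_le[OF fin])
  qed simp
qed

section \<open>Quadratic transport convergence\<close>

text \<open>The product measure is a coupling whose cost is at most twice the sum of the second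
  moments. Hence \<open>enn2real\<close> in \<open>W2\<close> does not send an infinite cost to 0,
  and smallness of \<open>W2\<close> yields cheap couplings.\<close>

lemma product_coupling_cost_finite:
  fixes p :: "'a::polish_space"
  assumes "\<mu> \<in> P2 p" "\<nu> \<in> P2 p"
  shows "(INF \<pi>\<in>couplings \<mu> \<nu>. \<integral>\<^sup>+z. ennreal ((dist (fst z) (snd z))\<^sup>2) \<partial>\<pi>) < \<infinity>"
proof -
  have sets [measurable_cong, simp]: "sets \<mu> = sets borel" "sets \<nu> = sets borel"
    and fin: "(\<integral>\<^sup>+x. ennreal ((dist p x)\<^sup>2) \<partial>\<mu>) < \<infinity>" "(\<integral>\<^sup>+x. ennreal ((dist p x)\<^sup>2) \<partial>\<nu>) < \<infinity>"
    and "prob_space \<mu>" "prob_space \<nu>"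
    using assms by (auto simp: P2_def)
  interpret \<mu>: prob_space \<mu> by fact
  interpret \<nu>: prob_space \<nu> by fact
  interpret P: pair_prob_space \<mu> \<nu> ..
  let ?P = "\<mu> \<Otimes>\<^sub>M \<nu>"
  \<comment> \<open>Second countability of the space identifies the product of the Borel
    sigma-algebras with the Borel sigma-algebra of the product.\<close>
  have sP: "sets ?P = sets borel"
    unfolding borel_prod[symmetric] by (intro sets_pair_measure_cong) auto
  have d1: "distr ?P borel fst = \<mu>"
    using distr_cong[OF refl, of \<mu> borel ?P fst fst] \<nu>.distr_pair_fst[of \<mu>] by simp
  have d2: "distr ?P borel snd = \<nu>"
  proof (rule measure_eqI)
    fix A assume "A \<in> sets (distr ?P borel snd)"
    then have A: "A \<in> sets borel" by simp
    have "space \<mu> = UNIV" "space \<nu> = UNIV"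
      using sets_eq_imp_space_eq[OF sets(1)] sets_eq_imp_space_eq[OF sets(2)] by auto
    then have "snd -` A \<inter> space ?P = space \<mu> \<times> A" by (auto simp: space_pair_measure)
    then show "emeasure (distr ?P borel snd) A = emeasure \<nu> A"
      using A \<nu>.emeasure_pair_measure_Times[OF sets.top, of A \<mu>]
      by (simp add: emeasure_distr \<mu>.emeasure_space_1)
  qed simp
  have "?P \<in> couplings \<mu> \<nu>"
    using d1 d2 sP P.prob_space_axioms by (simp add: couplings_def)
  then have "(INF \<pi>\<in>couplings \<mu> \<nu>. \<integral>\<^sup>+z. ennreal ((dist (fst z) (snd z))\<^sup>2) \<partial>\<pi>) \<le>
    (\<integral>\<^sup>+z. ennreal ((dist (fst z) (snd z))\<^sup>2) \<partial>?P)"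
    by (rule INF_lower)
  also have "\<dots> \<le> (\<integral>\<^sup>+z. 2 * ennreal ((dist p (fst z))\<^sup>2) + 2 * ennreal ((dist p (snd z))\<^sup>2) \<partial>?P)"
  proof (rule nn_integral_mono)
    fix z :: "'a \<times> 'a"
    let ?a = "dist p (fst z)" and ?b = "dist p (snd z)"
    have "dist (fst z) (snd z) \<le> ?a + ?b" by (metis dist_commute dist_triangle)
    then have "(dist (fst z) (snd z))\<^sup>2 \<le> (?a + ?b)\<^sup>2" by (intro power_mono) auto
    also have "\<dots> \<le> 2 * ?a\<^sup>2 + 2 * ?b\<^sup>2"
      using sum_squares_bound[of ?a ?b] by (simp add: power2_sum)
    finally have "ennreal ((dist (fst z) (snd z))\<^sup>2) \<le> ennreal (2 * ?a\<^sup>2 + 2 * ?b\<^sup>2)"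
      by (rule ennreal_leI)
    also have "\<dots> = 2 * ennreal (?a\<^sup>2) + 2 * ennreal (?b\<^sup>2)"
      by (simp add: ennreal_mult)
    finally show "ennreal ((dist (fst z) (snd z))\<^sup>2) \<le> 2 * ennreal (?a\<^sup>2) + 2 * ennreal (?b\<^sup>2)" .
  qed
  also have "\<dots> = 2 * (\<integral>\<^sup>+z. ennreal ((dist p (fst z))\<^sup>2) \<partial>?P) + 2 * (\<integral>\<^sup>+z. ennreal ((dist p (snd z))\<^sup>2) \<partial>?P)"
    by (simp add: nn_integral_add nn_integral_cmult)
  also have "(\<integral>\<^sup>+z. ennreal ((dist p (fst z))\<^sup>2) \<partial>?P) = (\<integral>\<^sup>+x. ennreal ((dist p x)\<^sup>2) \<partial>\<mu>)"
    using nn_integral_distr[of fst ?P borel "\<lambda>x. ennreal ((dist p x)\<^sup>2)"] by (simp add: d1)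
  also have "(\<integral>\<^sup>+z. ennreal ((dist p (snd z))\<^sup>2) \<partial>?P) = (\<integral>\<^sup>+x. ennreal ((dist p x)\<^sup>2) \<partial>\<nu>)"
    using nn_integral_distr[of snd ?P borel "\<lambda>x. ennreal ((dist p x)\<^sup>2)"] by (simp add: d2)
  also have "2 * (\<integral>\<^sup>+x. ennreal ((dist p x)\<^sup>2) \<partial>\<mu>) + 2 * (\<integral>\<^sup>+x. ennreal ((dist p x)\<^sup>2) \<partial>\<nu>) < \<infinity>"
    using fin by (simp add: ennreal_mult_less_top)
  finally show ?thesis .
qed

text \<open>Both integrals are written over the coupling, where the difference of the values of
  \<open>f\<close> is at most \<open>L\<close> times the distance of the two coordinates.
  Boundedness of \<open>f\<close> gives integrability.\<close>

lemma coupling_lipschitz_bound: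
  fixes f :: "'a::polish_space \<Rightarrow> real"
  assumes \<pi>: "\<pi> \<in> couplings \<mu> \<nu>" and cost: "(\<integral>\<^sup>+z. ennreal ((dist (fst z) (snd z))\<^sup>2) \<partial>\<pi>) < ennreal (e\<^sup>2)"
    and "0 < e" and L: "L-lipschitz_on UNIV f" and "bounded (range f)"
  shows "\<bar>integral\<^sup>L \<mu> f - integral\<^sup>L \<nu> f\<bar> \<le> L * e"
proof -
  have sets [measurable_cong, simp]: "sets \<pi> = sets borel" and "prob_space \<pi>"
    and d: "distr \<pi> borel fst = \<mu>" "distr \<pi> borel snd = \<nu>"
    using \<pi> by (auto simp: couplings_def)
  interpret prob_space \<pi> by fact
  have [measurable_cong]: "sets \<pi> = sets (borel \<Otimes>\<^sub>M borel)" unfolding borel_prod by simp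
  obtain B where B: "\<And>x. \<bar>f x\<bar> \<le> B" using assms(5) by (auto simp: bounded_iff)
  have [measurable]: "f \<in> borel_measurable borel"
    using L by (intro borel_measurable_continuous_onI lipschitz_on_continuous_on)
  have [measurable]: "fst \<in> measurable \<pi> borel" "snd \<in> measurable \<pi> borel" by measurable
  have int: "integrable \<pi> (\<lambda>z. f (fst z))" "integrable \<pi> (\<lambda>z. f (snd z))"
    using B by (auto intro!: integrable_const_bound[where B=B])
  let ?D = "\<lambda>z::'a \<times> 'a. dist (fst z) (snd z)"
  have [measurable]: "?D \<in> borel_measurable \<pi>" by measurable
  have intD: "integrable \<pi> (\<lambda>z. (?D z)\<^sup>2)"
    using cost by (intro integrableI_nonneg) (auto intro: less_trans)
  have "ennreal (\<integral>z. (?D z)\<^sup>2 \<partial>\<pi>) < ennreal (e\<^sup>2)"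
    using cost nn_integral_eq_integral[OF intD] by simp
  then have De: "(\<integral>z. (?D z)\<^sup>2 \<partial>\<pi>) < e\<^sup>2"
    by (subst (asm) ennreal_less_iff) (auto intro: integral_nonneg_AE)
  have L0: "0 \<le> L" using L by (rule lipschitz_on_nonneg)
  have "integral\<^sup>L \<mu> f - integral\<^sup>L \<nu> f = (\<integral>z. f (fst z) - f (snd z) \<partial>\<pi>)"
    using int unfolding d[symmetric] by (simp add: integral_distr)
  then have "\<bar>integral\<^sup>L \<mu> f - integral\<^sup>L \<nu> f\<bar> \<le> (\<integral>z. \<bar>f (fst z) - f (snd z)\<bar> \<partial>\<pi>)"
    using integral_abs_bound by metis
  \<comment> \<open>Expanding \<open>(?D z - e)\<^sup>2 \<ge> 0\<close> bounds the distance by its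
    square, in place of the Cauchy-Schwarz inequality; the resulting mean stays below
    \<open>e\<close>.\<close>
  also have "\<dots> \<le> (\<integral>z. L * ((e + (?D z)\<^sup>2 / e) / 2) \<partial>\<pi>)"
  proof (rule integral_mono)
    fix z
    have "0 \<le> (?D z - e)\<^sup>2" by simp
    then have "?D z \<le> (e + (?D z)\<^sup>2 / e) / 2"
      using \<open>0 < e\<close> by (simp add: field_simps power2_eq_square)
    then show "\<bar>f (fst z) - f (snd z)\<bar> \<le> L * ((e + (?D z)\<^sup>2 / e) / 2)"
      using lipschitz_onD[OF L, of "fst z" "snd z"] mult_left_mono[OF _ L0]
      unfolding dist_real_def by (meson UNIV_I order_trans)
  qed (use int intD in auto)
  also have "\<dots> = L * ((e + (\<integral>z. (?D z)\<^sup>2 \<partial>\<pi>) / e) / 2)"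
    using intD by (simp add: prob_space)
  also have "\<dots> \<le> L * e"
    using De \<open>0 < e\<close> L0 by (intro mult_left_mono) (auto simp: field_simps power2_eq_square)
  finally show ?thesis .
qed

lemma W2_conv_lipschitz:
  fixes f :: "'a::polish_space \<Rightarrow> real"
  assumes \<mu>: "\<And>n. \<mu> n \<in> P2 p" "\<mu>_lim \<in> P2 p" and W: "(\<lambda>n. W2 (\<mu> n) \<mu>_lim) \<longlonglongrightarrow> 0"
    and L: "L-lipschitz_on UNIV f" and "bounded (range f)"
  shows "(\<lambda>n. integral\<^sup>L (\<mu> n) f) \<longlonglongrightarrow> integral\<^sup>L \<mu>_lim f"
proof (rule LIMSEQ_I)
  fix \<epsilon> :: real assume "0 < \<epsilon>"
  have L0: "0 \<le> L" using L by (rule lipschitz_on_nonneg)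
  \<comment> \<open>The denominator \<open>L + 1\<close> covers \<open>L = 0\<close> and makes
    \<open>L * e < \<epsilon>\<close> strict.\<close>
  define e where "e = \<epsilon> / (L + 1)"
  have e: "0 < e" "L * e < \<epsilon>" using \<open>0 < \<epsilon>\<close> L0 by (auto simp: e_def field_simps)
  obtain n0 where n0: "\<And>n. n \<ge> n0 \<Longrightarrow> \<bar>W2 (\<mu> n) \<mu>_lim\<bar> < e"
    using LIMSEQ_D[OF W e(1)] by auto
  have "norm (integral\<^sup>L (\<mu> n) f - integral\<^sup>L \<mu>_lim f) < \<epsilon>" if "n \<ge> n0" for n
  proof -
    let ?c = "INF \<pi>\<in>couplings (\<mu> n) \<mu>_lim. \<integral>\<^sup>+z. ennreal ((dist (fst z) (snd z))\<^sup>2) \<partial>\<pi>"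
    obtain c where c: "?c = ennreal c" "0 \<le> c"
      using product_coupling_cost_finite[OF \<mu>(1)[of n] \<mu>(2)] by (cases ?c) auto
    have "sqrt c < e" using n0[OF that] c by (simp add: W2_def)
    then have "c < e\<^sup>2" using c(2) e(1) by (metis real_sqrt_less_iff real_sqrt_abs abs_of_pos)
    then have "?c < ennreal (e\<^sup>2)" using c by (simp add: ennreal_less_iff)
    \<comment> \<open>A coupling of cost below \<open>e\<^sup>2\<close> suffices, so no optimal
      coupling is needed.\<close>
    then obtain \<pi> where "\<pi> \<in> couplings (\<mu> n) \<mu>_lim" "(\<integral>\<^sup>+z. ennreal ((dist (fst z) (snd z))\<^sup>2) \<partial>\<pi>) < ennreal (e\<^sup>2)"
      unfolding INF_less_iff by blast
    from coupling_lipschitz_bound[OF this e(1) L assms(5)] e(2) show ?thesis by simp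
  qed
  then show "\<exists>n0. \<forall>n\<ge>n0. norm (integral\<^sup>L (\<mu> n) f - integral\<^sup>L \<mu>_lim f) < \<epsilon>" by blast
qed

theorem proposition4p8:
  fixes N :: real
    and p :: "'a::polish_space"
    and S :: "'a set"
    and \<nn> :: "nat \<Rightarrow> 'a measure" and \<nn>_lim :: "'a measure"
    and \<nu> :: "nat \<Rightarrow> 'a measure" and \<nu>_lim :: "'a measure"
  assumes "N < 0"
    and "closed S" and "interior S = {}"
    and "\<And>n. \<nn> n \<in> measures_off S" and "\<nn>_lim \<in> measures_off S"
    and "\<And>n. \<nu> n \<in> P2_off p S" and "\<nu>_lim \<in> P2_off p S"
    and "weak_star_conv_off S \<nn> \<nn>_lim"
  shows "(weak_conv_prob \<nu> \<nu>_lim \<longrightarrow>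
            renyi_entropy N \<nn>_lim \<nu>_lim \<le> liminf (\<lambda>n. renyi_entropy N (\<nn> n) (\<nu> n))) \<and>
         ((\<lambda>n. W2 (\<nu> n) \<nu>_lim) \<longlonglongrightarrow> 0 \<longrightarrow>
            renyi_entropy N \<nn>_lim \<nu>_lim \<le> liminf (\<lambda>n. renyi_entropy N (\<nn> n) (\<nu> n)))"
proof (intro conjI impI)
  assume "weak_conv_prob \<nu> \<nu>_lim"
  then show "renyi_entropy N \<nn>_lim \<nu>_lim \<le> liminf (\<lambda>n. renyi_entropy N (\<nn> n) (\<nu> n))"
    using assms by (intro renyi_entropy_lsc)
      (auto simp: weak_conv_prob_def intro: lipschitz_on_continuous_on)
next
  assume "(\<lambda>n. W2 (\<nu> n) \<nu>_lim) \<longlonglongrightarrow> 0"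
  moreover have "\<And>n. \<nu> n \<in> P2 p" "\<nu>_lim \<in> P2 p"
    using assms by (auto simp: P2_off_def)
  ultimately show "renyi_entropy N \<nn>_lim \<nu>_lim \<le> liminf (\<lambda>n. renyi_entropy N (\<nn> n) (\<nu> n))"
    using assms by (intro renyi_entropy_lsc W2_conv_lipschitz)
qed

end
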